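(* Let $\mathcal G_n$ be a set of graphs on $n$ vertices and let $d=d(n)\ge \log^3 n$. Suppose that for some positive constant $c$, for all $G_n\in\mathcal G_n$ the following properties hold. (i) For every $S\subseteq V(G_n)$ with $s=|S|$ and every $r\in\mathbb N$, $$\Big|\bigcup_{v\in S}N(v,r)\Big|\ge c\min\{sd^r,n\}.$$ Moreover, if $s$ and $r$ are such that $sd^r<n/\log n$, then $\big|\bigcup_{v\in S}N(v,r)\big|=(1+o(1))sd^r$. (ii) For every $v\in V(G_n)$ and every $r\in\mathbb N$ with $\sqrt n<d^{r+1}\le \sqrt n\log n$, there exists a family $\{W(u)\subseteq S(u,r+1): u\in S(v,r)\}$ of pairwise disjoint sets such that $|W(u)|=(1+o(1))d^{r+1}$ for each $u\in S(v,r)$. Then $c(G_n)=O(\sqrt n)$ for $G_n\in\mathcal G_n$.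
   Context: $\log$ is the natural logarithm. For a graph $G$, a vertex $v$ and $r\ge 0$, $S(v,r)$ is the set of vertices at distance exactly $r$ from $v$ and $N(v,r)$ is the set of vertices at distance at most $r$ from $v$. The $o(1)$ terms denote quantities tending to $0$ as $n\to\infty$, uniformly over the graphs in $\mathcal G_n$ and the quantified parameters; $O(\sqrt n)$ means bounded by a constant times $\sqrt n$ uniformly over $G_n\in\mathcal G_n$ for large $n$. The cop number $c(G)$ is the minimum number of cops that can guarantee capture of the robber in the game of Cops and Robbers on $G$ (cops choose initial vertices, then the robber; then cops and robber alternately move along an edge or stay put, with full information; the cops win if a cop occupies the robber's vertex). *)

theory Defs
  imports Complex_Main
begin

type_synonym 'a graph = "'a set \<times> ('a \<Rightarrow> 'a \<Rightarrow> bool)"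

definition verts :: "'a graph \<Rightarrow> 'a set" where "verts G = fst G"
definition adj :: "'a graph \<Rightarrow> 'a \<Rightarrow> 'a \<Rightarrow> bool" where "adj G = snd G"

definition simple_graph :: "'a graph \<Rightarrow> bool" where
  "simple_graph G \<longleftrightarrow> finite (verts G)
     \<and> (\<forall>u w. adj G u w \<longrightarrow> u \<in> verts G \<and> w \<in> verts G)
     \<and> (\<forall>u w. adj G u w \<longrightarrow> adj G w u)
     \<and> (\<forall>u. \<not> adj G u u)"

definition edge_rel :: "'a graph \<Rightarrow> ('a \<times> 'a) set" where
  "edge_rel G = {(u, w). adj G u w}"

definition ball_nbhd :: "'a graph \<Rightarrow> 'a \<Rightarrow> nat \<Rightarrow> 'a set" where
  "ball_nbhd G v r = {w. \<exists>k\<le>r. (v, w) \<in> edge_rel G ^^ k}"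

definition sphere_nbhd :: "'a graph \<Rightarrow> 'a \<Rightarrow> nat \<Rightarrow> 'a set" where
  "sphere_nbhd G v r = {w. (v, w) \<in> edge_rel G ^^ r \<and> \<not> (\<exists>k<r. (v, w) \<in> edge_rel G ^^ k)}"

text \<open>Cops and Robbers with k cops.  A cop configuration is a map nat => vertex
  (only indices < k matter).  cop_turn_win G k C r: cops to move, cops at C,
  robber at r, and the cops can force capture in finitely many rounds.
  rob_turn_win: same, robber to move.\<close>
definition captured :: "nat \<Rightarrow> (nat \<Rightarrow> 'a) \<Rightarrow> 'a \<Rightarrow> bool" where
  "captured k C r \<longleftrightarrow> (\<exists>i<k. C i = r)"

definition cop_move :: "'a graph \<Rightarrow> nat \<Rightarrow> (nat \<Rightarrow> 'a) \<Rightarrow> (nat \<Rightarrow> 'a) \<Rightarrow> bool" where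
  "cop_move G k C C' \<longleftrightarrow> (\<forall>i<k. C' i = C i \<or> adj G (C i) (C' i))"

inductive cop_turn_win :: "'a graph \<Rightarrow> nat \<Rightarrow> (nat \<Rightarrow> 'a) \<Rightarrow> 'a \<Rightarrow> bool"
  and rob_turn_win :: "'a graph \<Rightarrow> nat \<Rightarrow> (nat \<Rightarrow> 'a) \<Rightarrow> 'a \<Rightarrow> bool"
  for G :: "'a graph" and k :: nat where
  cap_c: "captured k C r \<Longrightarrow> cop_turn_win G k C r"
| move_c: "cop_move G k C C' \<Longrightarrow> rob_turn_win G k C' r \<Longrightarrow> cop_turn_win G k C r"
| cap_r: "captured k C r \<Longrightarrow> rob_turn_win G k C r"
| move_r: "(\<forall>r'. (r' = r \<or> adj G r r') \<longrightarrow> cop_turn_win G k C r') \<Longrightarrow> rob_turn_win G k C r"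

definition cops_win :: "'a graph \<Rightarrow> nat \<Rightarrow> bool" where
  "cops_win G k \<longleftrightarrow> (\<exists>C. (\<forall>i<k. C i \<in> verts G) \<and> (\<forall>r\<in>verts G. cop_turn_win G k C r))"

definition cop_number :: "'a graph \<Rightarrow> nat" where
  "cop_number G = (LEAST k. cops_win G k)"

end

theory Submission
  imports Defs "HOL-Library.FuncSet" "HOL-Real_Asymp.Real_Asymp"
begin

text \<open>Let \<open>L = ln n\<close>, let \<open>r\<close> be minimal with \<open>sqrt n < d^(r+1)\<close>, and put \<open>x = d^(r+1) / sqrt n\<close>. Cops placed
  at \<open>O(sqrt n)\<close> independent uniform vertices meet every relevant expanding union of balls in about as
  many cops as its size divided by \<open>sqrt n\<close>. By Hall's theorem, a prescribed set of \<open>O(sqrt n)\<close> vertices can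
  therefore be occupied within \<open>t\<close> cop moves as soon as \<open>d^t \<ge> sqrt n * L\<close>.

  If \<open>x \<ge> L\<close>, the ball of radius \<open>r\<close> around the robber is occupied after \<open>r+1\<close> cop moves, while
  the robber has moved only \<open>r\<close> times. If \<open>x < L\<close> and \<open>r \<ge> 1\<close>, the deficiency version of Hall's theorem
  still fills that ball up to a set \<open>U\<close> with \<open>|U| \<le> sqrt n / d\<close>, because the union bound only runs over
  sets with at least \<open>sqrt n / d\<close> elements; a robber who survives must be in \<open>U\<close>, and
  a second team occupies the closed neighbourhood of \<open>U\<close>, of size \<open>O(sqrt n)\<close>, one move later. If
  \<open>x < L\<close> and \<open>r = 0\<close>, a first team that does not move dominates the neighbours of the robber up to
  \<open>O(sqrt n)\<close> vertices, which a second team reaches in two moves.\<close>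

subsection \<open>Hall's theorem\<close>

text \<open>Induction on \<open>card I\<close>, split by whether some proper nonempty
  \<open>J\<close> is tight, that is, its sets cover exactly \<open>card J\<close> elements. A tight
  \<open>J\<close> is matched on its own, and the remaining indices outside what \<open>J\<close>
  covers. Without a tight \<open>J\<close> one index may take any of its elements, since every other
  condition has an element to spare.\<close>

theorem hall_sdr:
  fixes A :: "'i \<Rightarrow> 'b set"
  assumes "finite I" and "\<And>i. i \<in> I \<Longrightarrow> finite (A i)"
    and "\<And>J. J \<subseteq> I \<Longrightarrow> card J \<le> card (\<Union>i\<in>J. A i)"
  shows "\<exists>g. inj_on g I \<and> (\<forall>i\<in>I. g i \<in> A i)"
  using assms
proof (induction "card I" arbitrary: I A rule: less_induct)
  case less
  note fin = \<open>finite I\<close> and finA = less.prems(2) and hall = less.prems(3)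
  consider (empty) "I = {}"
    | (tight) J where "J \<subset> I" "J \<noteq> {}" "card (\<Union>i\<in>J. A i) = card J"
    | (slack) "I \<noteq> {}" "\<And>J. J \<subset> I \<Longrightarrow> J \<noteq> {} \<Longrightarrow> card J < card (\<Union>i\<in>J. A i)"
    using hall by (metis le_neq_implies_less psubset_imp_subset)
  then show ?case
  proof cases
    case empty
    then show ?thesis by simp
  next
    case tight
    have finJ: "finite J" using tight(1) fin by (meson finite_subset psubset_imp_subset)
    have "\<exists>g. inj_on g J \<and> (\<forall>i\<in>J. g i \<in> A i)"
      using tight(1) fin finA hall
      by (intro less.hyps psubset_card_mono finJ) (auto simp: subset_iff)
    then obtain g where g: "inj_on g J" "\<forall>i\<in>J. g i \<in> A i" by blast
    let ?B = "\<Union>i\<in>J. A i"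
    have finB: "finite ?B" using finJ finA tight(1) by auto
    have "\<exists>h. inj_on h (I - J) \<and> (\<forall>i\<in>I - J. h i \<in> A i - ?B)"
    proof (rule less.hyps)
      show "card (I - J) < card I" using tight fin by (intro psubset_card_mono) auto
      show "finite (I - J)" using fin by simp
      show "finite (A i - ?B)" if "i \<in> I - J" for i using that finA by auto
      show "card K \<le> card (\<Union>i\<in>K. A i - ?B)" if K: "K \<subseteq> I - J" for K
      proof -
        have finK: "finite K" using K fin by (meson finite_Diff finite_subset)
        \<comment> \<open>Hall's condition is applied to \<open>K \<union> J\<close>. As
          \<open>J\<close> covers only \<open>card J\<close> elements, at least
          \<open>card K\<close> must lie outside \<open>?B\<close>.\<close>
        have "card K + card J = card (K \<union> J)"
          using K finK finJ by (subst card_Un_disjoint) auto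
        also have "\<dots> \<le> card (\<Union>i\<in>K \<union> J. A i)" using K tight(1) by (intro hall) auto
        also have "(\<Union>i\<in>K \<union> J. A i) = (\<Union>i\<in>K. A i - ?B) \<union> ?B" by auto
        also have "card \<dots> \<le> card (\<Union>i\<in>K. A i - ?B) + card ?B" by (rule card_Un_le)
        finally show ?thesis using tight(3) by simp
      qed
    qed
    then obtain h where h: "inj_on h (I - J)" "\<forall>i\<in>I - J. h i \<in> A i - ?B" by blast
    have "inj_on (\<lambda>i. if i \<in> J then g i else h i) I"
    proof (rule inj_onI)
      fix a b assume "a \<in> I" "b \<in> I" "(if a \<in> J then g a else h a) = (if b \<in> J then g b else h b)"
      moreover have "g u \<noteq> h w" if "u \<in> J" "w \<in> I - J" for u w using that g h by auto
      ultimately show "a = b"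
        using inj_onD[OF g(1)] inj_onD[OF h(1)] by (metis DiffI)
    qed
    moreover have "\<forall>i\<in>I. (if i \<in> J then g i else h i) \<in> A i" using g h by auto
    ultimately show ?thesis by (intro exI[of _ "\<lambda>i. if i \<in> J then g i else h i"] conjI)
  next
    case slack
    obtain i0 where i0: "i0 \<in> I" using slack(1) by blast
    have "card {i0} \<le> card (\<Union>i\<in>{i0}. A i)" using i0 by (intro hall) auto
    then obtain x where x: "x \<in> A i0" by fastforce
    have "\<exists>h. inj_on h (I - {i0}) \<and> (\<forall>i\<in>I - {i0}. h i \<in> A i - {x})"
    proof (rule less.hyps)
      show "card (I - {i0}) < card I" using i0 fin by (intro psubset_card_mono) auto
      show "finite (I - {i0})" using fin by simp
      show "finite (A i - {x})" if "i \<in> I - {i0}" for i using that finA by auto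
      show "card K \<le> card (\<Union>i\<in>K. A i - {x})" if K: "K \<subseteq> I - {i0}" for K
      proof (cases "K = {}")
        case False
        have "card K < card (\<Union>i\<in>K. A i)" using K i0 False by (intro slack(2)) auto
        moreover have "(\<Union>i\<in>K. A i - {x}) = (\<Union>i\<in>K. A i) - {x}" by auto
        ultimately show ?thesis by (auto simp: card_Diff_singleton_if)
      qed simp
    qed
    then obtain h where h: "inj_on h (I - {i0})" "\<forall>i\<in>I - {i0}. h i \<in> A i - {x}" by blast
    have "inj_on (h(i0 := x)) I" using h by (auto simp: inj_on_def)
    moreover have "\<forall>i\<in>I. (h(i0 := x)) i \<in> A i" using h x by auto
    ultimately show ?thesis by blast
  qed
qed

text \<open>Adding the same \<open>T\<close> dummy elements to every \<open>A w\<close> restores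
  Hall's condition; the indices matched to dummies form the exceptional set
  \<open>U\<close>.\<close>

lemma hall_deficiency:
  fixes A :: "'i \<Rightarrow> 'b set"
  assumes B: "finite B" and finA: "\<And>w. w \<in> B \<Longrightarrow> finite (A w)"
    and hall: "\<And>S. S \<subseteq> B \<Longrightarrow> card S \<le> card (\<Union>w\<in>S. A w) + T"
  shows "\<exists>U g. U \<subseteq> B \<and> card U \<le> T \<and> inj_on g (B - U) \<and> (\<forall>w\<in>B - U. g w \<in> A w)"
proof -
  define A' where "A' w = Inl ` A w \<union> (Inr ` {..<T} :: ('b + nat) set)" for w
  have "\<exists>h. inj_on h B \<and> (\<forall>w\<in>B. h w \<in> A' w)"
  proof (rule hall_sdr[OF B])
    show "finite (A' w)" if "w \<in> B" for w using finA[OF that] by (simp add: A'_def)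
    show "card S \<le> card (\<Union>w\<in>S. A' w)" if S: "S \<subseteq> B" for S
    \<comment> \<open>The empty union contains no dummies, so the exact count below needs
      \<open>S\<close> nonempty.\<close>
    proof (cases "S = {}")
      case False
      have fin: "finite (\<Union>w\<in>S. A w)" using S B finA by (meson finite_UN finite_subset subsetD)
      have "(\<Union>w\<in>S. A' w) = Inl ` (\<Union>w\<in>S. A w) \<union> Inr ` {..<T}"
        using False by (auto simp: A'_def)
      also have "card \<dots> = card (\<Union>w\<in>S. A w) + T"
        using fin by (subst card_Un_disjoint) (auto simp: card_image)
      finally show ?thesis using hall[OF S] by simp
    qed simp
  qed
  then obtain h where h: "inj_on h B" "\<And>w. w \<in> B \<Longrightarrow> h w \<in> A' w" by blast
  define U where "U = {w \<in> B. h w \<in> Inr ` {..<T}}"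
  have "card U \<le> card ((Inr :: nat \<Rightarrow> 'b + nat) ` {..<T})"
    using h(1) by (intro card_inj_on_le[of h]) (auto simp: U_def inj_on_def)
  then have "card U \<le> T" by (simp add: card_image)
  moreover have proj: "h w = Inl (projl (h w))" "projl (h w) \<in> A w" if "w \<in> B - U" for w
    using that h(2)[of w] by (auto simp: U_def A'_def)
  have "inj_on (projl \<circ> h) (B - U)"
    using h(1) proj(1) by (metis (no_types, lifting) DiffD1 comp_apply inj_on_def)
  ultimately show ?thesis using proj(2) by (intro exI[of _ U] exI[of _ "projl \<circ> h"]) (auto simp: U_def)
qed

subsection \<open>Random teams\<close>

text \<open>A first moment argument with the weight \<open>2 ^ (s S - X)\<close>, where \<open>X\<close> counts the indices \<open>i\<close> with
  \<open>f i \<in> A S\<close>: it is at least \<open>1\<close> whenever \<open>S\<close> fails, so Chernoff bound and union bound become a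
  single averaging over all \<open>f\<close>.\<close>

lemma exists_hitting_sample:
  fixes A :: "'b \<Rightarrow> 'a set" and s :: "'b \<Rightarrow> nat"
  assumes V: "finite V" "V \<noteq> {}" and F: "finite F" and A: "\<And>S. S \<in> F \<Longrightarrow> A S \<subseteq> V"
    and small: "(\<Sum>S\<in>F. 2 ^ s S * exp (- (real k * real (card (A S)) / (2 * real (card V))))) < 1"
  shows "\<exists>f. (\<forall>i<k. f i \<in> V) \<and> (\<forall>S\<in>F. s S < card {i. i < k \<and> f i \<in> A S})"
proof (rule ccontr)
  assume neg: "\<not> ?thesis"
  define \<Omega> where "\<Omega> = ({..<k} \<rightarrow>\<^sub>E V)"
  define n where "n = real (card V)"
  have n: "n > 0" using V by (auto simp: n_def card_gt_0_iff)
  have fin\<Omega>: "finite \<Omega>" unfolding \<Omega>_def using V by (intro finite_PiE) auto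
  have card\<Omega>: "real (card \<Omega>) = n ^ k" unfolding \<Omega>_def n_def by (simp add: card_PiE)
  define X where "X f S = card {i. i < k \<and> f i \<in> A S}" for f S
  have moment: "(\<Sum>f\<in>\<Omega>. (1/2) ^ X f S) \<le> n ^ k * exp (- (real k * real (card (A S)) / (2 * n)))"
    if S: "S \<in> F" for S
  proof -
    let ?w = "\<lambda>v. if v \<in> A S then 1/2 else (1::real)"
    have "(1/2) ^ X f S = (\<Prod>i<k. ?w (f i))" for f
    proof -
      have "(\<Prod>i<k. ?w (f i)) = (\<Prod>i\<in>{i\<in>{..<k}. f i \<in> A S}. 1/2)"
        by (rule prod.mono_neutral_cong_right) auto
      then show ?thesis by (simp add: X_def)
    qed
    then have "(\<Sum>f\<in>\<Omega>. (1/2) ^ X f S) = (\<Sum>f\<in>\<Omega>. \<Prod>i<k. ?w (f i))" by simp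
    also have "\<dots> = (\<Prod>i<k. \<Sum>v\<in>V. ?w v)"
      unfolding \<Omega>_def by (rule prod_sum_PiE[symmetric]) (use V in auto)
    also have "(\<Sum>v\<in>V. ?w v) = n * (1 - real (card (A S)) / (2 * n))"
    proof -
      have "(\<Sum>v\<in>V. ?w v) = (\<Sum>v\<in>A S. 1/2) + (\<Sum>v\<in>V - A S. 1)"
        using V A[OF S] by (subst sum.subset_diff[of "A S" V]) (auto intro!: sum.cong)
      also have "\<dots> = n - real (card (A S)) / 2"
        using V A[OF S] by (simp add: n_def card_Diff_subset finite_subset of_nat_diff card_mono)
      also have "\<dots> = n * (1 - real (card (A S)) / (2 * n))" using n by (simp add: field_simps)
      finally show ?thesis .
    qed
    also have "(\<Prod>i<k. n * (1 - real (card (A S)) / (2 * n))) = n ^ k * (1 - real (card (A S)) / (2 * n)) ^ k"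
      by (simp add: power_mult_distrib)
    also have "\<dots> \<le> n ^ k * exp (- (real (card (A S)) / (2 * n))) ^ k"
    proof -
      have "card (A S) \<le> card V" using A[OF S] V by (intro card_mono)
      then have "0 \<le> 1 - real (card (A S)) / (2 * n)" using n by (simp add: field_simps n_def)
      moreover have "1 - real (card (A S)) / (2 * n) \<le> exp (- (real (card (A S)) / (2 * n)))"
        using exp_ge_add_one_self[of "- (real (card (A S)) / (2 * n))"] by simp
      ultimately show ?thesis using n by (intro mult_left_mono power_mono) auto
    qed
    also have "exp (- (real (card (A S)) / (2 * n))) ^ k = exp (- (real k * real (card (A S)) / (2 * n)))"
      by (simp flip: exp_of_nat_mult)
    finally show ?thesis .
  qed
  have fail: "(1::real) \<le> (\<Sum>S\<in>F. 2 ^ s S * (1/2) ^ X f S)" if f: "f \<in> \<Omega>" for f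
  proof -
    have "\<forall>i<k. f i \<in> V" using f by (auto simp: \<Omega>_def)
    then obtain S where S: "S \<in> F" "X f S \<le> s S" using neg by (force simp: X_def not_less)
    have "(1::real) = 2 ^ X f S * (1/2) ^ X f S" by (simp add: power_divide)
    also have "\<dots> \<le> 2 ^ s S * (1/2) ^ X f S" using S by (intro mult_right_mono power_increasing) auto
    also have "\<dots> \<le> (\<Sum>S\<in>F. 2 ^ s S * (1/2) ^ X f S)"
      by (rule member_le_sum[OF S(1) _ F]) auto
    finally show ?thesis .
  qed
  have "n ^ k = (\<Sum>f\<in>\<Omega>. 1)" using card\<Omega> by simp
  also have "\<dots> \<le> (\<Sum>f\<in>\<Omega>. \<Sum>S\<in>F. 2 ^ s S * (1/2) ^ X f S)" by (intro sum_mono fail)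
  also have "\<dots> = (\<Sum>S\<in>F. 2 ^ s S * (\<Sum>f\<in>\<Omega>. (1/2) ^ X f S))"
    by (subst sum.swap) (simp add: sum_distrib_left)
  also have "\<dots> \<le> (\<Sum>S\<in>F. 2 ^ s S * (n ^ k * exp (- (real k * real (card (A S)) / (2 * n)))))"
    by (intro sum_mono mult_left_mono moment) auto
  also have "\<dots> = n ^ k * (\<Sum>S\<in>F. 2 ^ s S * exp (- (real k * real (card (A S)) / (2 * n))))"
    by (simp add: sum_distrib_left mult_ac)
  also have "\<dots> < n ^ k * 1"
    using small n by (intro mult_strict_left_mono) (auto simp: n_def)
  finally show False by simp
qed

section \<open>Weighted sums over large subsets\<close>

lemma sum_Pow_power:
  fixes q :: "'b :: comm_semiring_1"
  assumes "finite B"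
  shows "(\<Sum>S\<in>Pow B. q ^ card S) = (1 + q) ^ card B"
  using prod_add[OF assms, of "\<lambda>_. q" "\<lambda>_. 1"] by (simp add: add.commute)

text \<open>Exponential tilting: on sets with at least \<open>T\<close> elements the factor
  \<open>exp (y * (card S - T))\<close> is at least \<open>1\<close>, so it may be inserted before
  the sum is extended to all subsets and evaluated by the binomial theorem. Each use picks its own
  \<open>y\<close>; this takes the place of estimates for binomial coefficients.\<close>

lemma sum_power_large_subsets_le:
  fixes q y T M :: real
  assumes B: "finite B" "real (card B) \<le> M" and q: "q \<ge> 0" and y: "y \<ge> 0"
  shows "(\<Sum>S | S \<subseteq> B \<and> real (card S) \<ge> T. q ^ card S) \<le> exp (M * (q * exp y) - y * T)"
proof -
  have "(\<Sum>S | S \<subseteq> B \<and> real (card S) \<ge> T. q ^ card S)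
      \<le> (\<Sum>S | S \<subseteq> B \<and> real (card S) \<ge> T. exp (- y * T) * (q * exp y) ^ card S)"
  proof (intro sum_mono)
    fix S assume "S \<in> {S. S \<subseteq> B \<and> real (card S) \<ge> T}"
    then have "y * T \<le> y * real (card S)" using y by (intro mult_left_mono) auto
    then have "1 \<le> exp (- y * T) * exp y ^ card S"
      by (simp add: mult.commute flip: exp_of_nat_mult exp_add)
    then have "q ^ card S * 1 \<le> q ^ card S * (exp (- y * T) * exp y ^ card S)"
      using q by (intro mult_left_mono) auto
    then show "q ^ card S \<le> exp (- y * T) * (q * exp y) ^ card S"
      by (simp add: power_mult_distrib mult_ac)
  qed
  also have "\<dots> \<le> (\<Sum>S\<in>Pow B. exp (- y * T) * (q * exp y) ^ card S)"
    using B q by (intro sum_mono2) auto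
  also have "\<dots> = exp (- y * T) * (1 + q * exp y) ^ card B"
    using B by (simp add: sum_Pow_power flip: sum_distrib_left)
  also have "\<dots> \<le> exp (- y * T) * exp (q * exp y) ^ card B"
    using q by (intro mult_left_mono power_mono) (auto intro: exp_ge_add_one_self)
  also have "\<dots> = exp (real (card B) * (q * exp y) - y * T)"
    by (simp add: mult_ac flip: exp_of_nat_mult exp_add)
  also have "\<dots> \<le> exp (M * (q * exp y) - y * T)" using B q by (simp add: mult_right_mono)
  finally show ?thesis .
qed

subsection \<open>Scheduled cop strategies\<close>

lemma ball_nbhd_0 [simp]: "ball_nbhd G v 0 = {v}"
  by (auto simp: ball_nbhd_def)

lemma ball_nbhd_Suc:
  "w \<in> ball_nbhd G v (Suc r) \<longleftrightarrow> (\<exists>u\<in>ball_nbhd G v r. w = u \<or> adj G u w)"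
proof
  assume "w \<in> ball_nbhd G v (Suc r)"
  then obtain k where k: "k \<le> Suc r" "(v, w) \<in> edge_rel G ^^ k" by (auto simp: ball_nbhd_def)
  show "\<exists>u\<in>ball_nbhd G v r. w = u \<or> adj G u w"
  proof (cases k)
    case 0
    then show ?thesis using k by (auto simp: ball_nbhd_def intro!: exI[of _ 0])
  next
    case (Suc j)
    then obtain u where "(v, u) \<in> edge_rel G ^^ j" "(u, w) \<in> edge_rel G" using k by auto
    then show ?thesis using k Suc by (auto simp: ball_nbhd_def edge_rel_def)
  qed
next
  assume "\<exists>u\<in>ball_nbhd G v r. w = u \<or> adj G u w"
  then obtain u k where "k \<le> r" "(v, u) \<in> edge_rel G ^^ k" "w = u \<or> adj G u w"
    by (auto simp: ball_nbhd_def)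
  then have "(v, w) \<in> edge_rel G ^^ k \<or> (v, w) \<in> edge_rel G ^^ Suc k"
    by (auto simp: edge_rel_def)
  then show "w \<in> ball_nbhd G v (Suc r)" using \<open>k \<le> r\<close> unfolding ball_nbhd_def
    by (metis (mono_tags, lifting) Suc_le_mono le_SucI mem_Collect_eq)
qed

lemma ball_nbhd_1: "w \<in> ball_nbhd G v 1 \<longleftrightarrow> w = v \<or> adj G v w"
  using ball_nbhd_Suc[of w G v 0] by simp

lemma ball_nbhd_subset_verts:
  assumes "simple_graph G" "v \<in> verts G"
  shows "ball_nbhd G v r \<subseteq> verts G"
proof (induction r)
  case (Suc r)
  then show ?case using assms by (auto simp: ball_nbhd_Suc simple_graph_def)
qed (use assms in simp)

lemma ball_nbhd_sym:
  assumes "simple_graph G"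
  shows "w \<in> ball_nbhd G v r \<longleftrightarrow> v \<in> ball_nbhd G w r"
proof -
  have "sym (edge_rel G)" using assms by (auto simp: edge_rel_def simple_graph_def sym_def)
  then have "sym (edge_rel G ^^ k)" for k
  proof (induction k)
    case (Suc k)
    then have "converse (edge_rel G ^^ k) = edge_rel G ^^ k" "converse (edge_rel G) = edge_rel G"
      by (auto simp: sym_conv_converse_eq)
    then have "converse (edge_rel G ^^ Suc k) = edge_rel G ^^ Suc k"
      by (simp add: converse_relcomp relpow_commute)
    then show ?case by (simp add: sym_conv_converse_eq del: relpow.simps)
  qed (auto simp: sym_def)
  then show ?thesis by (auto simp: ball_nbhd_def sym_def)
qed

lemma lazy_walk_exists:
  assumes "w \<in> ball_nbhd G v t"
  shows "\<exists>p. p 0 = v \<and> p t = w \<and> (\<forall>j. p (Suc j) = p j \<or> adj G (p j) (p (Suc j)))"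
  using assms
proof (induction t arbitrary: w)
  case 0
  then show ?case by (intro exI[of _ "\<lambda>_. v"]) auto
next
  case (Suc t)
  then obtain u where u: "u \<in> ball_nbhd G v t" "w = u \<or> adj G u w" by (auto simp: ball_nbhd_Suc)
  obtain p where p: "p 0 = v" "p t = u" "\<forall>j. p (Suc j) = p j \<or> adj G (p j) (p (Suc j))"
    using Suc.IH[OF u(1)] by blast
  show ?case
  proof (intro exI[of _ "\<lambda>j. if j \<le> t then p j else w"] conjI allI)
    fix j
    show "(if Suc j \<le> t then p (Suc j) else w) = (if j \<le> t then p j else w)
        \<or> adj G (if j \<le> t then p j else w) (if Suc j \<le> t then p (Suc j) else w)"
      using p u by (cases "j = t") (auto simp: not_le)
  qed (use p in auto)
qed

text \<open>A threatened robber is caught by the next cop move. Recording the threat instead of the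
  capture means that cops who need \<open>t + 1\<close> moves to occupy a set already threaten it at
  time \<open>t\<close>, which is where they gain one step on the robber.\<close>

definition threatens :: "'a graph \<Rightarrow> nat \<Rightarrow> (nat \<Rightarrow> 'a) \<Rightarrow> 'a \<Rightarrow> bool" where
  "threatens G k C x \<longleftrightarrow> (\<exists>i<k. C i = x \<or> adj G (C i) x)"

text \<open>\<open>P j i\<close> is the vertex of cop \<open>i\<close> after \<open>j\<close> moves.
  The moves are planned in advance: once the robber's starting vertex is known, the cops leave the
  plan only to capture.\<close>

definition schedule :: "'a graph \<Rightarrow> nat \<Rightarrow> (nat \<Rightarrow> nat \<Rightarrow> 'a) \<Rightarrow> bool" where
  "schedule G k P \<longleftrightarrow> (\<forall>j. cop_move G k (P j) (P (Suc j)))"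

lemma threatens_imp_cop_turn_win:
  assumes "threatens G k C x"
  shows "cop_turn_win G k C x"
proof -
  obtain i where i: "i < k" "C i = x \<or> adj G (C i) x" using assms by (auto simp: threatens_def)
  have "cop_move G k C (C(i := x))" using i by (auto simp: cop_move_def)
  moreover have "rob_turn_win G k (C(i := x)) x"
    using i by (intro cap_r) (auto simp: captured_def)
  ultimately show ?thesis by (rule move_c)
qed

text \<open>\<open>R j\<close> contains every position the robber can hold after \<open>j\<close>
  moves without having been threatened before. Backward induction from round \<open>m\<close>: a
  threatened robber is caught at once, and any other robber moves into
  \<open>R (Suc j)\<close>.\<close>

lemma schedule_imp_cop_turn_win:
  assumes "schedule G k P"
    and escape: "\<And>j x y. j < m \<Longrightarrow> x \<in> R j \<Longrightarrow> \<not> threatens G k (P j) x \<Longrightarrow>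
      y = x \<or> adj G x y \<Longrightarrow> y \<in> R (Suc j)"
    and final: "\<And>x. x \<in> R m \<Longrightarrow> threatens G k (P m) x"
    and "j \<le> m" "x \<in> R j"
  shows "cop_turn_win G k (P j) x"
  using \<open>j \<le> m\<close> \<open>x \<in> R j\<close>
proof (induction j arbitrary: x rule: inc_induct)
  case base
  then show ?case by (intro threatens_imp_cop_turn_win final)
next
  case (step j)
  show ?case
  proof (cases "threatens G k (P j) x")
    case True
    then show ?thesis by (rule threatens_imp_cop_turn_win)
  next
    case False
    have "rob_turn_win G k (P (Suc j)) x"
      using step.IH escape[OF step.hyps(2) step.prems False] by (intro move_r) blast
    then show ?thesis using assms(1) by (auto simp: schedule_def intro: move_c)
  qed
qed

text \<open>After \<open>r\<close> moves the robber is still in the ball of radius \<open>r\<close>,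
  so it survives only inside \<open>U\<close>; one move later it is in the closed neighbourhood of
  \<open>U\<close>, which is threatened by then. With \<open>U = {}\<close> this is a plain
  encirclement.\<close>

lemma surround_imp_cop_turn_win:
  assumes P: "schedule G k P"
    and inner: "\<And>x. x \<in> ball_nbhd G v r - U \<Longrightarrow> threatens G k (P r) x"
    and outer: "\<And>x. x \<in> (\<Union>u\<in>U. ball_nbhd G u 1) \<Longrightarrow> threatens G k (P (Suc r)) x"
  shows "cop_turn_win G k (P 0) v"
proof (rule schedule_imp_cop_turn_win[OF P])
  let ?R = "\<lambda>j. if j \<le> r then ball_nbhd G v j else (\<Union>u\<in>U. ball_nbhd G u 1)"
  show "y \<in> ?R (Suc j)"
    if "j < Suc r" "x \<in> ?R j" "\<not> threatens G k (P j) x" "y = x \<or> adj G x y" for j x y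
  proof (cases "j = r")
    case True
    then have "x \<in> U" using that inner by auto
    then show ?thesis using True that by (auto simp: ball_nbhd_1 simp del: One_nat_def)
  next
    case False
    then show ?thesis using that by (auto simp: ball_nbhd_Suc)
  qed
  show "threatens G k (P (Suc r)) x" if "x \<in> ?R (Suc r)" for x
    using that outer by simp
qed auto

text \<open>Injectivity of \<open>g\<close> gives each cop at most one target, so all assigned cops
  can walk to their targets at the same time; the others stand still.\<close>

lemma matching_schedule:
  assumes g: "inj_on g B" and B: "\<And>w. w \<in> B \<Longrightarrow> g w < k \<and> w \<in> ball_nbhd G (f (g w)) (Suc t)"
  shows "\<exists>P. P 0 = f \<and> schedule G k P \<and> (\<forall>w\<in>B. threatens G k (P t) w)"
proof -
  have "\<exists>p. p 0 = f i \<and> (\<forall>w\<in>B. g w = i \<longrightarrow> p (Suc t) = w)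
      \<and> (\<forall>j. p (Suc j) = p j \<or> adj G (p j) (p (Suc j)))" for i
  proof (cases "i \<in> g ` B")
    case True
    then obtain w where w: "w \<in> B" "i = g w" by blast
    obtain p where "p 0 = f i" "p (Suc t) = w" "\<forall>j. p (Suc j) = p j \<or> adj G (p j) (p (Suc j))"
      using lazy_walk_exists B[OF w(1)] w(2) by metis
    then show ?thesis using w g by (intro exI[of _ p]) (auto dest: inj_onD)
  qed (intro exI[of _ "\<lambda>_. f i"], auto)
  then obtain p where p: "\<And>i. p i 0 = f i" "\<And>i w. w \<in> B \<Longrightarrow> g w = i \<Longrightarrow> p i (Suc t) = w"
    "\<And>i j. p i (Suc j) = p i j \<or> adj G (p i j) (p i (Suc j))" by metis
  show ?thesis
  proof (intro exI[of _ "\<lambda>j i. p i j"] conjI ballI)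
    show "schedule G k (\<lambda>j i. p i j)" using p(3) by (auto simp: schedule_def cop_move_def)
    \<comment> \<open>The walk ends at \<open>w\<close> at time \<open>Suc t\<close>, so at time
      \<open>t\<close> it is at \<open>w\<close> or at a neighbour.\<close>
    show "threatens G k (\<lambda>i. p i t) w" if "w \<in> B" for w
      unfolding threatens_def using p(2)[OF that refl] p(3)[of "g w" t] B[OF that]
      by (intro exI[of _ "g w"]) auto
  qed (use p(1) in auto)
qed

definition join_teams :: "nat \<Rightarrow> (nat \<Rightarrow> 'a) \<Rightarrow> (nat \<Rightarrow> 'a) \<Rightarrow> nat \<Rightarrow> 'a" where
  "join_teams k f g i = (if i < k then f i else g (i - k))"

lemma schedule_join_teams:
  assumes "schedule G k P" "schedule G l Q"
  shows "schedule G (k + l) (\<lambda>j. join_teams k (P j) (Q j))"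
  using assms by (auto simp: schedule_def cop_move_def join_teams_def)

lemma threatens_join_teams:
  assumes "threatens G k C x \<or> threatens G l D x"
  shows "threatens G (k + l) (join_teams k C D) x"
  using assms
proof
  assume "threatens G k C x"
  then obtain i where "i < k" "C i = x \<or> adj G (C i) x" by (auto simp: threatens_def)
  then show ?thesis unfolding threatens_def by (intro exI[of _ i]) (auto simp: join_teams_def)
next
  assume "threatens G l D x"
  then obtain i where "i < l" "D i = x \<or> adj G (D i) x" by (auto simp: threatens_def)
  then show ?thesis unfolding threatens_def by (intro exI[of _ "k + i"]) (auto simp: join_teams_def)
qed

lemma cop_number_le:
  assumes "\<And>i. i < k \<Longrightarrow> C i \<in> verts G" "\<And>v. v \<in> verts G \<Longrightarrow> cop_turn_win G k C v"
  shows "cop_number G \<le> k"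
  unfolding cop_number_def using assms by (intro Least_le) (auto simp: cops_win_def)

subsection \<open>Expanding graphs\<close>

text \<open>\<open>(ln n)\<^sup>2 < sqrt n\<close> puts sizes up to \<open>sqrt n * ln n\<close>
  below \<open>n / ln n\<close>, where the upper bound on unions of balls applies. The next two
  conditions serve the union bound in \<open>exists_matching_team\<close>, the last one that in
  \<open>cop_number_le_if_degree_large\<close>.\<close>

definition large_order :: "real \<Rightarrow> bool" where
  "large_order n \<longleftrightarrow> n \<ge> 1 \<and> ln n \<ge> 2 \<and> (ln n)\<^sup>2 < sqrt n \<and> 4 * sqrt n * exp (- (4 * ln n)) \<le> 1
    \<and> n * (exp (1 - 2 * ln n) + exp (- (2 * sqrt n))) < 1 \<and> n * exp (2 * ln n - 2 * sqrt n) < 1"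

lemma eventually_large_order: "eventually large_order at_top"
  unfolding large_order_def by (intro eventually_conj; real_asymp)

text \<open>One fixed graph, free of asymptotics: the factor \<open>2\<close> in
  \<open>card_balls_le\<close> stands for \<open>1 + o(1)\<close>.\<close>

locale expander_graph =
  fixes G :: "'a graph" and d c n L :: real
  defines "n \<equiv> real (card (verts G))" and "L \<equiv> ln n"
  assumes simple: "simple_graph G" and large: "large_order n" and c_pos: "c > 0"
    and d_ge: "d \<ge> L ^ 3"
    and expand: "S \<subseteq> verts G \<Longrightarrow>
      real (card (\<Union>v\<in>S. ball_nbhd G v r)) \<ge> c * min (real (card S) * d ^ r) n"
    and card_balls_le: "S \<subseteq> verts G \<Longrightarrow> real (card S) * d ^ r < n / L \<Longrightarrow>
      real (card (\<Union>v\<in>S. ball_nbhd G v r)) \<le> 2 * (real (card S) * d ^ r)"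
begin

text \<open>The sampling exponent is \<open>k * card A / (2 * n)\<close>. With
  \<open>card A \<ge> c * min (s * d ^ t) n\<close> and \<open>k = 12 / c * sqrt n\<close>, it is at
  least \<open>6 * min (s * d ^ t / sqrt n) (sqrt n)\<close>.\<close>

definition team_size :: nat where "team_size = nat \<lceil>12 / c * sqrt n\<rceil>"

section \<open>Numerical bounds and sizes of balls\<close>

lemma L_ge: "L \<ge> 2" and L2_less: "L\<^sup>2 < sqrt n" and n_ge_1: "n \<ge> 1"
  using large by (auto simp: large_order_def L_def)

lemma exp_L: "exp L = n"
  using n_ge_1 by (simp add: L_def)

lemma sqrt_n: "sqrt n * sqrt n = n" "sqrt n \<ge> 1" "L < sqrt n" "sqrt n * L < n / L" "sqrt n < n / L"
proof -
  show 1: "sqrt n * sqrt n = n" and "sqrt n \<ge> 1" using n_ge_1 by auto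
  have "L * 1 \<le> L * L" using L_ge by (intro mult_left_mono) auto
  then show "L < sqrt n" using L2_less by (simp add: power2_eq_square)
  have "sqrt n * L\<^sup>2 < sqrt n * sqrt n" using L2_less n_ge_1 by (intro mult_strict_left_mono) auto
  then have "sqrt n * L * L < n" using 1 by (simp add: power2_eq_square mult_ac)
  then show 2: "sqrt n * L < n / L" using L_ge by (simp add: field_simps)
  have "sqrt n * 1 \<le> sqrt n * L" using L_ge n_ge_1 by (intro mult_left_mono) auto
  then show "sqrt n < n / L" using 2 by linarith
qed

text \<open>One of the three logarithms in \<open>d \<ge> L ^ 3\<close> pays for the factor
  \<open>2\<close>. The two others are spent in the case \<open>r \<ge> 1\<close>, where
  \<open>2 * (x * x) \<le> d\<close> is needed for \<open>x \<le> L\<close>.\<close>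

lemma d_ge_L2: "d \<ge> 2 * L\<^sup>2"
proof -
  have "2 * L\<^sup>2 \<le> L * L\<^sup>2" using L_ge by (intro mult_right_mono) auto
  also have "\<dots> = L ^ 3" by (simp add: power3_eq_cube power2_eq_square)
  finally show ?thesis using d_ge by linarith
qed

lemma d_ge_L: "d \<ge> L" "d > 1"
proof -
  have "L * 1 \<le> L * L" using L_ge by (intro mult_left_mono) auto
  then show "d \<ge> L" using d_ge_L2 L_ge unfolding power2_eq_square by linarith
  then show "d > 1" using L_ge by linarith
qed

lemma finite_verts: "finite (verts G)" and verts_nonempty: "verts G \<noteq> {}"
proof -
  show "finite (verts G)" using simple by (simp add: simple_graph_def)
  show "verts G \<noteq> {}" using n_ge_1 by (auto simp: n_def)
qed

lemma ball_subset: "v \<in> verts G \<Longrightarrow> ball_nbhd G v r \<subseteq> verts G"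
  using ball_nbhd_subset_verts[OF simple] .

lemma finite_ball: "v \<in> verts G \<Longrightarrow> finite (ball_nbhd G v r)"
  using ball_subset finite_verts by (rule finite_subset)

lemma card_ball_le:
  assumes "v \<in> verts G" "d ^ r < n / L"
  shows "real (card (ball_nbhd G v r)) \<le> 2 * d ^ r"
  using card_balls_le[of "{v}" r] assms by simp

lemma team_size: "team_size \<ge> 12 / c * sqrt n" "team_size \<le> 12 / c * sqrt n + 1"
proof -
  have "0 \<le> 12 / c * sqrt n" using c_pos n_ge_1 by simp
  then show "team_size \<ge> 12 / c * sqrt n" "team_size \<le> 12 / c * sqrt n + 1"
    unfolding team_size_def by linarith+
qed

section \<open>Random teams in expanding graphs\<close>

text \<open>One team must serve every starting vertex \<open>v\<close> of the robber, so the union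
  bound runs over pairs \<open>(v, S)\<close>; this is the factor \<open>n\<close> in
  \<open>n * \<rho> < 1\<close>.\<close>

lemma exists_team:
  fixes F :: "'a \<Rightarrow> 'a set set" and s :: "'a set \<Rightarrow> nat"
  assumes F: "\<And>v. v \<in> verts G \<Longrightarrow> F v \<subseteq> Pow (verts G)"
    and small: "\<And>v. v \<in> verts G \<Longrightarrow>
      (\<Sum>S\<in>F v. 2 ^ s S * exp (- 6 * min (real (card S) * d ^ t / sqrt n) (sqrt n))) \<le> \<rho>"
    and \<rho>: "n * \<rho> < 1"
  shows "\<exists>f. (\<forall>i<team_size. f i \<in> verts G) \<and> (\<forall>v\<in>verts G. \<forall>S\<in>F v.
    s S < card {i. i < team_size \<and> (\<exists>w\<in>S. w \<in> ball_nbhd G (f i) t)})"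
proof -
  define A where "A p = (\<Union>w\<in>snd p. ball_nbhd G w t)" for p :: "'a \<times> 'a set"
  define \<F> where "\<F> = (SIGMA v:verts G. F v)"
  have finF: "finite (F v)" if "v \<in> verts G" for v
    using F[OF that] finite_verts by (meson finite_Pow_iff finite_subset)
  have bound: "exp (- (real team_size * real (card (A (v, S))) / (2 * n)))
      \<le> exp (- 6 * min (real (card S) * d ^ t / sqrt n) (sqrt n))"
    if "v \<in> verts G" "S \<in> F v" for v S
  proof -
    let ?m = "min (real (card S) * d ^ t) n"
    have S: "S \<subseteq> verts G" using F that by blast
    have m: "?m \<ge> 0" using d_ge_L n_ge_1 by simp
    have "12 / c * sqrt n * (c * ?m) \<le> real team_size * real (card (A (v, S)))"
      using team_size(1) expand[OF S, of t] c_pos m by (intro mult_mono) (auto simp: A_def)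
    then have "12 * sqrt n * ?m / (2 * n) \<le> real team_size * real (card (A (v, S))) / (2 * n)"
      using n_ge_1 c_pos by (intro divide_right_mono) auto
    moreover have "12 * sqrt n * ?m / (2 * n) = 6 * (?m / sqrt n)"
      using n_ge_1 sqrt_n(1) by (simp add: field_simps)
    moreover have "?m / sqrt n = min (real (card S) * d ^ t / sqrt n) (sqrt n)"
      using n_ge_1 sqrt_n(1) by (auto simp: min_def field_simps)
    ultimately show ?thesis by simp
  qed
  have "\<exists>f. (\<forall>i<team_size. f i \<in> verts G)
      \<and> (\<forall>p\<in>\<F>. s (snd p) < card {i. i < team_size \<and> f i \<in> A p})"
  proof (rule exists_hitting_sample[OF finite_verts verts_nonempty])
    show "finite \<F>" unfolding \<F>_def using finite_verts finF by (intro finite_SigmaI)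
    show "A p \<subseteq> verts G" if "p \<in> \<F>" for p
      using that F ball_subset unfolding A_def \<F>_def by fastforce
    have "(\<Sum>p\<in>\<F>. 2 ^ s (snd p) * exp (- (real team_size * real (card (A p)) / (2 * n))))
        = (\<Sum>v\<in>verts G. \<Sum>S\<in>F v. 2 ^ s S * exp (- (real team_size * real (card (A (v, S))) / (2 * n))))"
      unfolding \<F>_def using finite_verts finF by (subst sum.Sigma) (auto simp: case_prod_unfold)
    also have "\<dots> \<le> (\<Sum>v\<in>verts G. \<rho>)"
    proof (rule sum_mono)
      fix v assume v: "v \<in> verts G"
      show "(\<Sum>S\<in>F v. 2 ^ s S * exp (- (real team_size * real (card (A (v, S))) / (2 * n)))) \<le> \<rho>"
        by (rule order_trans[OF _ small[OF v]]) (intro sum_mono mult_left_mono bound v; simp)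
    qed
    also have "\<dots> = n * \<rho>" by (simp add: n_def)
    finally show "(\<Sum>p\<in>\<F>. 2 ^ s (snd p) *
        exp (- (real team_size * real (card (A p)) / (2 * real (card (verts G)))))) < 1"
      using \<rho> by (simp add: n_def)
  qed
  then obtain f where f: "\<And>i. i < team_size \<Longrightarrow> f i \<in> verts G"
    "\<And>v S. v \<in> verts G \<Longrightarrow> S \<in> F v \<Longrightarrow> s S < card {i. i < team_size \<and> f i \<in> A (v, S)}"
    by (auto simp: \<F>_def)
  \<comment> \<open>By symmetry of distance, a cop sampled within distance \<open>t\<close> of
    \<open>S\<close> is a cop that can reach \<open>S\<close> in \<open>t\<close> moves.\<close>
  moreover have "f i \<in> A (v, S) \<longleftrightarrow> (\<exists>w\<in>S. w \<in> ball_nbhd G (f i) t)" for i v S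
    using ball_nbhd_sym[OF simple] by (auto simp: A_def)
  ultimately show ?thesis by (intro exI[of _ f]) auto
qed

lemma hits_Union:
  "(\<Union>w\<in>S. {i. i < k \<and> w \<in> ball_nbhd G (f i) t}) = {i. i < k \<and> (\<exists>w\<in>S. w \<in> ball_nbhd G (f i) t)}"
  by auto

text \<open>A set \<open>S\<close> of \<open>s\<close> targets expects at least a constant times
  \<open>min (s * L) (sqrt n)\<close> cops in range. The first value beats the number of choices of
  \<open>S\<close> size by size, the second beats all subsets of \<open>B v\<close> at once because
  \<open>card (B v) \<le> 2 * sqrt n\<close>. Hall's theorem then assigns the cops.\<close>

lemma exists_matching_team:
  assumes B: "\<And>v. v \<in> verts G \<Longrightarrow> B v \<subseteq> verts G"
    "\<And>v. v \<in> verts G \<Longrightarrow> real (card (B v)) \<le> 2 * sqrt n"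
    and t: "sqrt n * L \<le> d ^ Suc t"
  shows "\<exists>f. (\<forall>i<team_size. f i \<in> verts G) \<and> (\<forall>v\<in>verts G. \<exists>P. P 0 = f
    \<and> schedule G team_size P \<and> (\<forall>w\<in>B v. threatens G team_size (P t) w))"
proof -
  \<comment> \<open>The empty set is left out because it cannot be hit more than \<open>0\<close>
    times; the form \<open>real (card S) \<ge> 1\<close> fits
    \<open>sum_power_large_subsets_le\<close> with \<open>T = 1\<close>.\<close>
  define F where "F v = {S. S \<subseteq> B v \<and> real (card S) \<ge> 1}" for v
  define \<rho> where "\<rho> = exp (1 - 2 * L) + exp (- (2 * sqrt n))"
  have "\<exists>f. (\<forall>i<team_size. f i \<in> verts G) \<and> (\<forall>v\<in>verts G. \<forall>S\<in>F v.
    card S < card {i. i < team_size \<and> (\<exists>w\<in>S. w \<in> ball_nbhd G (f i) (Suc t))})"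
  proof (rule exists_team)
    show "F v \<subseteq> Pow (verts G)" if "v \<in> verts G" for v using B(1)[OF that] by (auto simp: F_def)
    show "n * \<rho> < 1" using large by (simp add: \<rho>_def large_order_def L_def)
    fix v assume v: "v \<in> verts G"
    have finB: "finite (B v)" using B(1)[OF v] finite_verts by (rule finite_subset)
    have "(\<Sum>S\<in>F v. 2 ^ card S * exp (- 6 * min (real (card S) * d ^ Suc t / sqrt n) (sqrt n)))
        \<le> (\<Sum>S\<in>F v. (2 * exp (- (6 * L))) ^ card S + 2 ^ card S * exp (- (6 * sqrt n)))"
    proof (intro sum_mono)
      fix S
      let ?s = "real (card S)"
      have "L \<le> d ^ Suc t / sqrt n" using t n_ge_1 by (simp add: field_simps)
      then have "?s * L \<le> ?s * (d ^ Suc t / sqrt n)" by (intro mult_left_mono) auto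
      \<comment> \<open>Whichever argument attains the minimum, the exponential is at most the sum
        of the two terms.\<close>
      then have "exp (- 6 * min (?s * d ^ Suc t / sqrt n) (sqrt n)) \<le> exp (- (?s * (6 * L))) + exp (- (6 * sqrt n))"
        by (cases "?s * d ^ Suc t / sqrt n \<le> sqrt n") (auto simp: min_def intro: add_increasing add_increasing2)
      then have "2 ^ card S * exp (- 6 * min (?s * d ^ Suc t / sqrt n) (sqrt n))
          \<le> 2 ^ card S * (exp (- (?s * (6 * L))) + exp (- (6 * sqrt n)))"
        by (intro mult_left_mono) auto
      also have "exp (- (?s * (6 * L))) = exp (- (6 * L)) ^ card S"
        by (simp flip: exp_of_nat_mult)
      finally show "2 ^ card S * exp (- 6 * min (?s * d ^ Suc t / sqrt n) (sqrt n))
          \<le> (2 * exp (- (6 * L))) ^ card S + 2 ^ card S * exp (- (6 * sqrt n))"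
        by (simp add: power_mult_distrib distrib_left)
    qed
    also have "\<dots> = (\<Sum>S\<in>F v. (2 * exp (- (6 * L))) ^ card S) + (\<Sum>S\<in>F v. 2 ^ card S) * exp (- (6 * sqrt n))"
      by (simp add: sum.distrib sum_distrib_right)
    also have "\<dots> \<le> exp (1 - 2 * L) + exp (4 * sqrt n) * exp (- (6 * sqrt n))"
    proof (intro add_mono mult_right_mono)
      \<comment> \<open>Tilt \<open>y = 2 * L\<close>: the condition of at least one element gains
        \<open>exp (- 2 * L)\<close>, enough to beat the \<open>n\<close> starting vertices, while
        the main term stays below \<open>1\<close>.\<close>
      have "(\<Sum>S\<in>F v. (2 * exp (- (6 * L))) ^ card S)
          \<le> exp (2 * sqrt n * (2 * exp (- (6 * L)) * exp (2 * L)) - 2 * L * 1)"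
        unfolding F_def using finB B(2)[OF v] L_ge by (intro sum_power_large_subsets_le) auto
      also have "2 * sqrt n * (2 * exp (- (6 * L)) * exp (2 * L)) = 4 * sqrt n * exp (- (4 * L))"
        by (simp flip: exp_add)
      also have "\<dots> \<le> 1" using large by (simp add: large_order_def L_def)
      finally show "(\<Sum>S\<in>F v. (2 * exp (- (6 * L))) ^ card S) \<le> exp (1 - 2 * L)" by simp
      have "(\<Sum>S\<in>F v. (2::real) ^ card S) \<le> exp (2 * sqrt n * (2 * exp 0) - 0 * 1)"
        unfolding F_def using finB B(2)[OF v] by (intro sum_power_large_subsets_le) auto
      then show "(\<Sum>S\<in>F v. (2::real) ^ card S) \<le> exp (4 * sqrt n)" by simp
    qed simp
    also have "\<dots> = \<rho>" by (simp add: \<rho>_def flip: exp_add)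
    finally show "(\<Sum>S\<in>F v. 2 ^ card S * exp (- 6 * min (real (card S) * d ^ Suc t / sqrt n) (sqrt n))) \<le> \<rho>" .
  qed
  then obtain f where f: "\<And>i. i < team_size \<Longrightarrow> f i \<in> verts G"
    and hit: "\<And>v S. v \<in> verts G \<Longrightarrow> S \<in> F v \<Longrightarrow>
      card S < card {i. i < team_size \<and> (\<exists>w\<in>S. w \<in> ball_nbhd G (f i) (Suc t))}" by blast
  have "\<exists>P. P 0 = f \<and> schedule G team_size P \<and> (\<forall>w\<in>B v. threatens G team_size (P t) w)"
    if v: "v \<in> verts G" for v
  proof -
    have finB: "finite (B v)" using B(1)[OF v] finite_verts by (rule finite_subset)
    have "\<exists>g. inj_on g (B v) \<and> (\<forall>w\<in>B v. g w \<in> {i. i < team_size \<and> w \<in> ball_nbhd G (f i) (Suc t)})"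
    proof (rule hall_sdr[OF finB])
      show "card S \<le> card (\<Union>w\<in>S. {i. i < team_size \<and> w \<in> ball_nbhd G (f i) (Suc t)})" if "S \<subseteq> B v" for S
      proof (cases "S = {}")
        case False
        then have "S \<in> F v" using that finB by (auto simp: F_def Suc_le_eq card_gt_0_iff finite_subset)
        then show ?thesis using hit[OF v] unfolding hits_Union by fastforce
      qed simp
    qed simp
    then show ?thesis using matching_schedule[of _ "B v" team_size G f t] by blast
  qed
  then show ?thesis using f by blast
qed

section \<open>The three ranges of \<open>d ^ Suc r\<close>\<close>

text \<open>The ball of radius \<open>r\<close> has at most \<open>2 * sqrt n\<close> vertices, so
  one team is matched onto all of it and threatens it by time \<open>r\<close>.\<close>

lemma cop_number_le_if_one_step_large:
  assumes "sqrt n * L \<le> d ^ Suc r" "d ^ r \<le> sqrt n"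
  shows "cop_number G \<le> team_size"
proof -
  have "d ^ r < n / L" using assms(2) sqrt_n by linarith
  then have "\<exists>f. (\<forall>i<team_size. f i \<in> verts G) \<and> (\<forall>v\<in>verts G. \<exists>P. P 0 = f
      \<and> schedule G team_size P \<and> (\<forall>w\<in>ball_nbhd G v r. threatens G team_size (P r) w))"
    using assms card_ball_le ball_subset by (intro exists_matching_team) force+
  then obtain f where f: "\<And>i. i < team_size \<Longrightarrow> f i \<in> verts G"
    and P: "\<And>v. v \<in> verts G \<Longrightarrow> \<exists>P. P 0 = f
      \<and> schedule G team_size P \<and> (\<forall>w\<in>ball_nbhd G v r. threatens G team_size (P r) w)" by blast
  have "cop_turn_win G team_size f v" if v: "v \<in> verts G" for v
  proof -
    obtain P where P: "P 0 = f" "schedule G team_size P"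
      "\<And>w. w \<in> ball_nbhd G v r \<Longrightarrow> threatens G team_size (P r) w" using P[OF v] by blast
    have "cop_turn_win G team_size (P 0) v"
      by (rule surround_imp_cop_turn_win[OF P(2), where U = "{}" and r = r]) (auto intro: P(3))
    then show ?thesis using P(1) by simp
  qed
  then show ?thesis using f by (intro cop_number_le)
qed

text \<open>The first team may leave two kinds of gaps: \<open>W v\<close>, covered by the second
  team at the same time, and \<open>U v\<close>, whose closed neighbourhood is covered one move
  later. Each application takes one of them empty.\<close>

lemma two_teams_cop_number_le:
  assumes f: "\<And>i. i < team_size \<Longrightarrow> f i \<in> verts G"
    and g: "\<And>i. i < team_size \<Longrightarrow> g i \<in> verts G"
    and P: "\<And>v. v \<in> verts G \<Longrightarrow> \<exists>P. P 0 = f \<and> schedule G team_size P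
      \<and> (\<forall>w\<in>ball_nbhd G v r - (U v \<union> W v). threatens G team_size (P r) w)"
    and Q: "\<And>v. v \<in> verts G \<Longrightarrow> \<exists>Q. Q 0 = g \<and> schedule G team_size Q
      \<and> (\<forall>w\<in>W v. threatens G team_size (Q r) w)
      \<and> (\<forall>w\<in>(\<Union>u\<in>U v. ball_nbhd G u 1). threatens G team_size (Q (Suc r)) w)"
  shows "cop_number G \<le> team_size + team_size"
proof (rule cop_number_le)
  show "join_teams team_size f g i \<in> verts G" if "i < team_size + team_size" for i
    using that f g by (auto simp: join_teams_def)
  fix v assume v: "v \<in> verts G"
  obtain P Q where P: "P 0 = f" "schedule G team_size P"
      "\<And>w. w \<in> ball_nbhd G v r - (U v \<union> W v) \<Longrightarrow> threatens G team_size (P r) w"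
    and Q: "Q 0 = g" "schedule G team_size Q" "\<And>w. w \<in> W v \<Longrightarrow> threatens G team_size (Q r) w"
      "\<And>w. w \<in> (\<Union>u\<in>U v. ball_nbhd G u 1) \<Longrightarrow> threatens G team_size (Q (Suc r)) w"
    using P[OF v] Q[OF v] by blast
  let ?J = "\<lambda>j. join_teams team_size (P j) (Q j)"
  have "cop_turn_win G (team_size + team_size) (?J 0) v"
  proof (rule surround_imp_cop_turn_win)
    show "schedule G (team_size + team_size) ?J" using P(2) Q(2) by (rule schedule_join_teams)
    show "threatens G (team_size + team_size) (?J r) x" if "x \<in> ball_nbhd G v r - U v" for x
      using that P(3) Q(3) by (intro threatens_join_teams) blast
    show "threatens G (team_size + team_size) (?J (Suc r)) x"
      if "x \<in> (\<Union>u\<in>U v. ball_nbhd G u 1)" for x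
      using Q(4)[OF that] by (intro threatens_join_teams) blast
  qed
  then show "cop_turn_win G (team_size + team_size) (join_teams team_size f g) v"
    using P(1) Q(1) by simp
qed

text \<open>Any \<open>m\<close> vertices, with \<open>m\<close> about \<open>n / d\<close>, have
  closed neighbourhoods covering at least \<open>c * n\<close> vertices, so a random team misses
  them with probability at most \<open>exp (- (6 * sqrt n))\<close>. This beats the number of
  \<open>m\<close>-subsets of a closed neighbourhood, hence fewer than \<open>m\<close> of its
  vertices escape a team that stands still.\<close>

lemma cop_number_le_if_degree_large:
  assumes d: "sqrt n < d" "d \<le> sqrt n * L"
  shows "cop_number G \<le> team_size + team_size"
proof -
  define x where "x = d / sqrt n"
  have x: "1 < x" "x \<le> L" "d = x * sqrt n" using d n_ge_1 by (auto simp: x_def field_simps)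
  define m where "m = nat \<lceil>n / d\<rceil>"
  have "n / d = sqrt n / x" using x n_ge_1 sqrt_n(1) by (simp add: field_simps)
  moreover have "sqrt n / x \<le> sqrt n" using x n_ge_1 by (simp add: field_simps)
  moreover have "0 \<le> n / d" using d_ge_L n_ge_1 by simp
  ultimately have m: "n / d \<le> real m" "real m \<le> sqrt n / x + 1" "real m \<le> sqrt n + 1"
    unfolding m_def by linarith+
  define F where "F v = {S. S \<subseteq> ball_nbhd G v 1 \<and> card S = m}" for v
  have "\<exists>f. (\<forall>i<team_size. f i \<in> verts G) \<and> (\<forall>v\<in>verts G. \<forall>S\<in>F v.
    0 < card {i. i < team_size \<and> (\<exists>w\<in>S. w \<in> ball_nbhd G (f i) 1)})"
  proof (rule exists_team)
    show "F v \<subseteq> Pow (verts G)" if "v \<in> verts G" for v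
      using ball_subset[OF that, of 1] by (auto simp: F_def)
    show "n * exp (2 * L - 2 * sqrt n) < 1" using large by (simp add: large_order_def L_def)
    fix v assume v: "v \<in> verts G"
    have ball: "real (card (ball_nbhd G v 1)) \<le> 2 * d"
      using card_ball_le[OF v, of 1] d sqrt_n(4) by simp
    have "(\<Sum>S\<in>F v. 2 ^ 0 * exp (- 6 * min (real (card S) * d ^ 1 / sqrt n) (sqrt n)))
        = (\<Sum>S\<in>F v. exp (- (6 * sqrt n)))"
    proof (intro sum.cong refl)
      fix S assume "S \<in> F v"
      then have "card S = m" by (simp add: F_def)
      moreover have "n \<le> real m * d" using m(1) d_ge_L by (simp add: field_simps)
      then have "sqrt n \<le> real m * d / sqrt n" using sqrt_n(1) n_ge_1 by (simp add: field_simps)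
      ultimately show "2 ^ 0 * exp (- 6 * min (real (card S) * d ^ 1 / sqrt n) (sqrt n)) = exp (- (6 * sqrt n))"
        by (simp add: min_def)
    qed
    \<comment> \<open>The \<open>m\<close>-subsets are counted with weight
      \<open>1 / x\<^sup>2\<close> per element: the weighted sum is at most
      \<open>exp (2 * d / x\<^sup>2)\<close>, where
      \<open>2 * d / x\<^sup>2 = 2 * sqrt n / x\<close>, and the compensation
      \<open>(x\<^sup>2) ^ m\<close> is harmless since \<open>m\<close> is at most
      \<open>sqrt n / x + 1\<close> and \<open>ln x \<le> x\<close>.\<close>
    also have "\<dots> = (\<Sum>S\<in>F v. (1 / x\<^sup>2) ^ card S) * ((x\<^sup>2) ^ m * exp (- (6 * sqrt n)))"
      unfolding sum_distrib_right using x by (intro sum.cong) (auto simp: F_def power_divide)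
    also have "\<dots> \<le> exp (2 * sqrt n) * (exp (2 * sqrt n + 2 * L) * exp (- (6 * sqrt n)))"
    proof (intro mult_mono)
      have "(\<Sum>S\<in>F v. (1 / x\<^sup>2) ^ card S)
          \<le> (\<Sum>S | S \<subseteq> ball_nbhd G v 1 \<and> real (card S) \<ge> 0. (1 / x\<^sup>2) ^ card S)"
        unfolding F_def using finite_ball[OF v, of 1] by (intro sum_mono2) auto
      also have "\<dots> \<le> exp (2 * d * (1 / x\<^sup>2 * exp 0) - 0 * 0)"
        using ball finite_ball[OF v, of 1] by (intro sum_power_large_subsets_le) auto
      also have "2 * d * (1 / x\<^sup>2 * exp 0) - 0 * 0 = 2 * (sqrt n / x)"
        using x by (simp add: power2_eq_square)
      also have "\<dots> \<le> 2 * sqrt n" using x n_ge_1 by (simp add: field_simps)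
      finally show "(\<Sum>S\<in>F v. (1 / x\<^sup>2) ^ card S) \<le> exp (2 * sqrt n)" by simp
      have "real m * ln x \<le> (sqrt n / x + 1) * ln x" using m x by (intro mult_right_mono) auto
      also have "\<dots> = sqrt n * (ln x / x) + ln x" by (simp add: field_simps)
      also have "\<dots> \<le> sqrt n * 1 + L"
      proof -
        have "ln x \<le> x" using ln_le_minus_one[of x] x by simp
        then show ?thesis using x n_ge_1 by (intro add_mono mult_left_mono) (auto simp: field_simps)
      qed
      finally have "2 * (real m * ln x) \<le> 2 * sqrt n + 2 * L" by simp
      moreover have "(x\<^sup>2) ^ m = exp (2 * (real m * ln x))"
      proof -
        have "exp (2 * (real m * ln x)) = exp (real (2 * m) * ln x)" by simp
        also have "\<dots> = x ^ (2 * m)" using x by (subst exp_of_nat_mult) simp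
        finally show ?thesis by (simp add: power_mult)
      qed
      ultimately show "(x\<^sup>2) ^ m \<le> exp (2 * sqrt n + 2 * L)" by simp
    qed (auto intro: sum_nonneg)
    also have "\<dots> = exp (2 * L - 2 * sqrt n)" by (simp flip: exp_add)
    finally show "(\<Sum>S\<in>F v. 2 ^ 0 * exp (- 6 * min (real (card S) * d ^ 1 / sqrt n) (sqrt n)))
      \<le> exp (2 * L - 2 * sqrt n)" .
  qed
  then obtain f where f: "\<And>i. i < team_size \<Longrightarrow> f i \<in> verts G"
    and hit: "\<And>v S. v \<in> verts G \<Longrightarrow> S \<in> F v \<Longrightarrow>
      card {i. i < team_size \<and> (\<exists>w\<in>S. w \<in> ball_nbhd G (f i) 1)} > 0"
    by blast
  define W where "W v = {w \<in> ball_nbhd G v 1. \<not> threatens G team_size f w}" for v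
  have W_verts: "W v \<subseteq> verts G" if "v \<in> verts G" for v
    using ball_subset[OF that] unfolding W_def by blast
  have W_card: "real (card (W v)) \<le> 2 * sqrt n" if v: "v \<in> verts G" for v
  proof -
    have "card (W v) < m"
    proof (rule ccontr)
      assume "\<not> card (W v) < m"
      then obtain S where S: "S \<subseteq> W v" "card S = m"
        by (meson not_less obtain_subset_with_card_n)
      then have "S \<in> F v" by (auto simp: F_def W_def)
      then obtain i w where "i < team_size" "w \<in> S" "w \<in> ball_nbhd G (f i) 1"
        using hit[OF v] by (force simp: card_gt_0_iff simp del: One_nat_def)
      then show False using S by (auto simp: W_def threatens_def ball_nbhd_1 simp del: One_nat_def)
    qed
    then show ?thesis using m(3) sqrt_n(2) by linarith
  qed
  \<comment> \<open>The second team has two moves, the second being the capture, and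
    \<open>d * d\<close> is large enough for a matching.\<close>
  have "sqrt n * L \<le> sqrt n * sqrt n" using sqrt_n by (intro mult_left_mono) auto
  also have "\<dots> \<le> d * d" using d d_ge_L n_ge_1 by (intro mult_mono) auto
  finally have "sqrt n * L \<le> d ^ Suc 1" by simp
  then obtain g where g: "\<And>i. i < team_size \<Longrightarrow> g i \<in> verts G"
    and Q: "\<And>v. v \<in> verts G \<Longrightarrow> \<exists>Q. Q 0 = g \<and> schedule G team_size Q
      \<and> (\<forall>w\<in>W v. threatens G team_size (Q 1) w)"
    using exists_matching_team[of W 1] W_card W_verts by blast
  show ?thesis
  proof (rule two_teams_cop_number_le[where r = 1 and W = W and U = "\<lambda>_. {}", OF f g])
    show "\<exists>P. P 0 = f \<and> schedule G team_size P
      \<and> (\<forall>w\<in>ball_nbhd G v 1 - ({} \<union> W v). threatens G team_size (P 1) w)" for v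
      by (intro exI[of _ "\<lambda>_. f"]) (auto simp: schedule_def cop_move_def W_def)
    show "\<exists>Q. Q 0 = g \<and> schedule G team_size Q \<and> (\<forall>w\<in>W v. threatens G team_size (Q 1) w)
      \<and> (\<forall>w\<in>(\<Union>u\<in>{}. ball_nbhd G u 1). threatens G team_size (Q (Suc 1)) w)"
      if "v \<in> verts G" for v
      using Q[OF that] by simp
  qed
qed

text \<open>With \<open>D = d ^ r\<close>, the threshold \<open>D / x\<close> equals
  \<open>sqrt n / d\<close>. Only sets above it enter the union bound, so the matching misses a set
  \<open>U\<close> of at most that size, whose closed neighbourhood has at most
  \<open>2 * sqrt n\<close> vertices.\<close>

lemma cop_number_le_if_radius_pos:
  assumes r: "r \<ge> 1" and d: "d ^ r \<le> sqrt n" "sqrt n < d ^ Suc r" "d ^ Suc r \<le> sqrt n * L"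
  shows "cop_number G \<le> team_size + team_size"
proof -
  define x where "x = d ^ Suc r / sqrt n"
  have x: "1 < x" "x \<le> L" "d ^ Suc r = x * sqrt n" using d n_ge_1 by (auto simp: x_def field_simps)
  define D where "D = d ^ r"
  have "d ^ 1 \<le> d ^ r" using r d_ge_L by (intro power_increasing) auto
  then have D: "D \<ge> L" "D > 0" using d_ge_L by (auto simp: D_def)
  have Dd: "D * d = x * sqrt n" using x(3) by (simp add: D_def mult.commute)
  \<comment> \<open>This keeps \<open>card S * x\<close> below \<open>sqrt n\<close> for all
    \<open>S\<close> in the ball, so the minimum in the exponent is always its first
    argument.\<close>
  have D_x: "2 * D * x \<le> sqrt n"
  proof -
    have "x * x \<le> L * L" using x by (intro mult_mono) auto
    then have "2 * (x * x) \<le> d" using d_ge_L2 by (simp add: power2_eq_square)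
    then have "2 * (x * x) * D \<le> d * D" using D by (intro mult_right_mono) auto
    then have "x * (2 * D * x) \<le> x * sqrt n" using Dd by (simp add: mult_ac)
    then show ?thesis using x by simp
  qed
  have ball: "real (card (ball_nbhd G v r)) \<le> 2 * D" if "v \<in> verts G" for v
    using card_ball_le[OF that] d sqrt_n unfolding D_def by force
  define F where "F v = {S. S \<subseteq> ball_nbhd G v r \<and> real (card S) \<ge> D / x}" for v
  have "\<exists>f. (\<forall>i<team_size. f i \<in> verts G) \<and> (\<forall>v\<in>verts G. \<forall>S\<in>F v.
    card S < card {i. i < team_size \<and> (\<exists>w\<in>S. w \<in> ball_nbhd G (f i) (Suc r))})"
  proof (rule exists_team)
    show "F v \<subseteq> Pow (verts G)" if "v \<in> verts G" for v
      using ball_subset[OF that, of r] by (auto simp: F_def)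
    have "n * exp (- (2 * L)) = exp (L - 2 * L)" unfolding exp_diff exp_minus exp_L by (simp add: field_simps)
    also have "\<dots> < 1" using L_ge by simp
    finally show "n * exp (- (2 * L)) < 1" .
    fix v assume v: "v \<in> verts G"
    have "(\<Sum>S\<in>F v. 2 ^ card S * exp (- 6 * min (real (card S) * d ^ Suc r / sqrt n) (sqrt n)))
        = (\<Sum>S\<in>F v. (2 * exp (- (6 * x))) ^ card S)"
    proof (intro sum.cong refl)
      fix S assume "S \<in> F v"
      then have "card S \<le> card (ball_nbhd G v r)"
        using finite_ball[OF v] by (intro card_mono) (auto simp: F_def)
      then have "real (card S) * x \<le> 2 * D * x" using ball[OF v] x by (intro mult_right_mono) auto
      then have "real (card S) * x \<le> sqrt n" using D_x by linarith
      moreover have "real (card S) * d ^ Suc r / sqrt n = real (card S) * x" by (simp add: x_def)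
      ultimately have "min (real (card S) * d ^ Suc r / sqrt n) (sqrt n) = real (card S) * x" by simp
      then show "2 ^ card S * exp (- 6 * min (real (card S) * d ^ Suc r / sqrt n) (sqrt n))
          = (2 * exp (- (6 * x))) ^ card S"
        by (simp add: power_mult_distrib mult_ac flip: exp_of_nat_mult)
    qed
    \<comment> \<open>Tilt \<open>y = 3 * x\<close>: the threshold \<open>D / x\<close> then
      contributes exactly \<open>- 3 * D\<close>, while the main term is at most
      \<open>D\<close>.\<close>
    also have "\<dots> \<le> exp (2 * D * (2 * exp (- (6 * x)) * exp (3 * x)) - 3 * x * (D / x))"
      unfolding F_def using ball[OF v] finite_ball[OF v] x by (intro sum_power_large_subsets_le) auto
    also have "2 * D * (2 * exp (- (6 * x)) * exp (3 * x)) - 3 * x * (D / x) = D * (4 * exp (- (3 * x))) - 3 * D"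
      using x by (simp flip: exp_add)
    also have "\<dots> \<le> D * 1 - 3 * D"
    proof -
      have "4 \<le> exp (3 * x)" using exp_ge_add_one_self[of "3 * x"] x by linarith
      then have "4 * exp (- (3 * x)) \<le> 1" by (simp add: exp_minus field_simps)
      then show ?thesis using D by (intro diff_right_mono mult_left_mono) auto
    qed
    also have "\<dots> \<le> - (2 * L)" using D by simp
    finally show "(\<Sum>S\<in>F v. 2 ^ card S * exp (- 6 * min (real (card S) * d ^ Suc r / sqrt n) (sqrt n)))
      \<le> exp (- (2 * L))" by simp
  qed
  then obtain f where f: "\<And>i. i < team_size \<Longrightarrow> f i \<in> verts G"
    and hit: "\<And>v S. v \<in> verts G \<Longrightarrow> S \<in> F v \<Longrightarrow>
      card S < card {i. i < team_size \<and> (\<exists>w\<in>S. w \<in> ball_nbhd G (f i) (Suc r))}" by blast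
  \<comment> \<open>A set with fewer than \<open>D / x\<close> elements has at most \<open>T\<close>
    elements, so for it the deficiency form of Hall's condition is automatic.\<close>
  define T where "T = nat \<lfloor>D / x\<rfloor>"
  have "0 \<le> D / x" using D x by simp
  then have T: "real T \<le> D / x" "D / x < real T + 1" unfolding T_def by linarith+
  have "\<exists>U. U \<subseteq> ball_nbhd G v r \<and> card U \<le> T \<and> (\<exists>P. P 0 = f \<and> schedule G team_size P
      \<and> (\<forall>w\<in>ball_nbhd G v r - U. threatens G team_size (P r) w))" if v: "v \<in> verts G" for v
  proof -
    have "\<exists>U g. U \<subseteq> ball_nbhd G v r \<and> card U \<le> T \<and> inj_on g (ball_nbhd G v r - U)
      \<and> (\<forall>w\<in>ball_nbhd G v r - U. g w \<in> {i. i < team_size \<and> w \<in> ball_nbhd G (f i) (Suc r)})"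
    proof (rule hall_deficiency[OF finite_ball[OF v]])
      show "card S \<le> card (\<Union>w\<in>S. {i. i < team_size \<and> w \<in> ball_nbhd G (f i) (Suc r)}) + T"
        if S: "S \<subseteq> ball_nbhd G v r" for S
      proof (cases "real (card S) \<ge> D / x")
        case True
        then show ?thesis using hit[OF v, of S] S unfolding hits_Union F_def by auto
      next
        case False
        then show ?thesis using T by linarith
      qed
    qed simp
    then obtain U g where U: "U \<subseteq> ball_nbhd G v r" "card U \<le> T" and g: "inj_on g (ball_nbhd G v r - U)"
      "\<And>w. w \<in> ball_nbhd G v r - U \<Longrightarrow> g w < team_size \<and> w \<in> ball_nbhd G (f (g w)) (Suc r)" by blast
    show ?thesis using U matching_schedule[OF g] by blast
  qed
  then obtain U where U: "\<And>v. v \<in> verts G \<Longrightarrow> U v \<subseteq> ball_nbhd G v r \<and> card (U v) \<le> T"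
    and P: "\<And>v. v \<in> verts G \<Longrightarrow> \<exists>P. P 0 = f \<and> schedule G team_size P
      \<and> (\<forall>w\<in>ball_nbhd G v r - U v. threatens G team_size (P r) w)" by metis
  define W where "W v = (\<Union>u\<in>U v. ball_nbhd G u 1)" for v
  have U_verts: "U v \<subseteq> verts G" if "v \<in> verts G" for v
    using U[OF that] ball_subset[OF that, of r] by blast
  have W_verts: "W v \<subseteq> verts G" if "v \<in> verts G" for v
    using U_verts[OF that] ball_subset[of _ 1] unfolding W_def by blast
  have W_card: "real (card (W v)) \<le> 2 * sqrt n" if v: "v \<in> verts G" for v
  proof -
    have "real (card (U v)) \<le> D / x" using U[OF v] T by linarith
    then have "real (card (U v)) * d \<le> D / x * d" using d_ge_L by (intro mult_right_mono) auto
    also have "\<dots> = sqrt n" using Dd x by (simp add: field_simps)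
    finally have *: "real (card (U v)) * d \<le> sqrt n" .
    then show ?thesis using card_balls_le[OF U_verts[OF v], of 1] sqrt_n unfolding W_def by simp
  qed
  \<comment> \<open>The additional round brings one more factor \<open>d \<ge> L\<close>, which
    lifts \<open>d ^ Suc r > sqrt n\<close> to the size a full matching needs.\<close>
  have "sqrt n * L \<le> d ^ Suc r * d" using d d_ge_L L_ge n_ge_1 by (intro mult_mono) auto
  then have "sqrt n * L \<le> d ^ Suc (Suc r)" by (simp add: mult.commute)
  then obtain g where g: "\<And>i. i < team_size \<Longrightarrow> g i \<in> verts G"
    and Q: "\<And>v. v \<in> verts G \<Longrightarrow> \<exists>Q. Q 0 = g \<and> schedule G team_size Q
      \<and> (\<forall>w\<in>W v. threatens G team_size (Q (Suc r)) w)"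
    using exists_matching_team[of W "Suc r"] W_card W_verts by blast
  show ?thesis
  proof (rule two_teams_cop_number_le[where r = r and U = U and W = "\<lambda>_. {}", OF f g])
    show "\<exists>P. P 0 = f \<and> schedule G team_size P
      \<and> (\<forall>w\<in>ball_nbhd G v r - (U v \<union> {}). threatens G team_size (P r) w)" if "v \<in> verts G" for v
      using P[OF that] by (simp only: Un_empty_right)
    show "\<exists>Q. Q 0 = g \<and> schedule G team_size Q \<and> (\<forall>w\<in>{}. threatens G team_size (Q r) w)
      \<and> (\<forall>w\<in>(\<Union>u\<in>U v. ball_nbhd G u 1). threatens G team_size (Q (Suc r)) w)"
      if "v \<in> verts G" for v
      using Q[OF that] by (simp only: W_def ball_empty simp_thms)
  qed
qed

lemma cop_number_le_sqrt: "real (cop_number G) \<le> (24 / c + 2) * sqrt n"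
proof -
  obtain j where "sqrt n < d ^ j" using real_arch_pow[OF d_ge_L(2)] by blast
  moreover have "d ^ j \<le> d ^ Suc j" using d_ge_L by (intro power_increasing) auto
  ultimately have ex: "sqrt n < d ^ Suc j" by linarith
  define r where "r = (LEAST j. sqrt n < d ^ Suc j)"
  have upper: "sqrt n < d ^ Suc r" unfolding r_def by (rule LeastI[of _ j], rule ex)
  \<comment> \<open>Minimality of \<open>r\<close>; for \<open>r = 0\<close> the claim is only
    \<open>1 \<le> sqrt n\<close>.\<close>
  have lower: "d ^ r \<le> sqrt n"
  proof (cases r)
    case (Suc i)
    then show ?thesis using not_less_Least[of i "\<lambda>j. sqrt n < d ^ Suc j"] by (simp add: r_def)
  qed (use n_ge_1 in simp)
  have "cop_number G \<le> team_size + team_size"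
  proof (cases "sqrt n * L \<le> d ^ Suc r")
    case True
    then show ?thesis using cop_number_le_if_one_step_large[OF True lower] by simp
  next
    case False
    then show ?thesis
      using cop_number_le_if_degree_large cop_number_le_if_radius_pos[OF _ lower upper] upper
      by (cases "r = 0") auto
  qed
  then have "real (cop_number G) \<le> 2 * real team_size" by linarith
  also have "\<dots> \<le> 2 * (12 / c * sqrt n + 1)" using team_size(2) by simp
  \<comment> \<open>\<open>sqrt n \<ge> 1\<close> absorbs the rounding in the two team
    sizes.\<close>
  also have "\<dots> \<le> (24 / c + 2) * sqrt n" using sqrt_n(2) by (simp add: algebra_simps)
  finally show ?thesis .
qed

end

section \<open>From single graphs to the uniform asymptotic bound\<close>

theorem theorem2p1:
  fixes Gs :: "nat \<Rightarrow> 'a graph set" and d :: "nat \<Rightarrow> real" and c :: real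
    and eps :: "nat \<Rightarrow> real"
  assumes graphs: "\<And>n G. G \<in> Gs n \<Longrightarrow> simple_graph G \<and> card (verts G) = n"
    and d_ge: "\<And>n. d n \<ge> ln (real n) ^ 3"
    and c_pos: "c > 0"
    and eps_lim: "eps \<longlonglongrightarrow> 0"
    and prop_i: "\<And>n G S r. G \<in> Gs n \<Longrightarrow> S \<subseteq> verts G \<Longrightarrow>
        real (card (\<Union>v\<in>S. ball_nbhd G v r)) \<ge> c * min (real (card S) * d n ^ r) (real n)"
    and prop_i_sharp: "\<And>n G S r. G \<in> Gs n \<Longrightarrow> S \<subseteq> verts G \<Longrightarrow>
        real (card S) * d n ^ r < real n / ln (real n) \<Longrightarrow>
        \<bar>real (card (\<Union>v\<in>S. ball_nbhd G v r)) - real (card S) * d n ^ r\<bar>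
          \<le> eps n * (real (card S) * d n ^ r)"
    and prop_ii: "\<And>n G v r. G \<in> Gs n \<Longrightarrow> v \<in> verts G \<Longrightarrow>
        sqrt (real n) < d n ^ (r + 1) \<Longrightarrow> d n ^ (r + 1) \<le> sqrt (real n) * ln (real n) \<Longrightarrow>
        (\<exists>W :: 'a \<Rightarrow> 'a set.
           (\<forall>u\<in>sphere_nbhd G v r. W u \<subseteq> sphere_nbhd G u (r + 1)
               \<and> \<bar>real (card (W u)) - d n ^ (r + 1)\<bar> \<le> eps n * d n ^ (r + 1))
         \<and> (\<forall>u\<in>sphere_nbhd G v r. \<forall>u'\<in>sphere_nbhd G v r. u \<noteq> u' \<longrightarrow> W u \<inter> W u' = {}))"
  shows "\<exists>K N0. \<forall>n\<ge>N0. \<forall>G\<in>Gs n. real (cop_number G) \<le> K * sqrt (real n)"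
proof -
  have "eventually (\<lambda>n. large_order (real n)) sequentially"
    using eventually_large_order filterlim_real_sequentially by (rule eventually_compose_filterlim)
  \<comment> \<open>Once \<open>eps n < 1\<close>, the sharp estimate in (i) yields the factor
    \<open>2\<close> of the locale.\<close>
  moreover have "eventually (\<lambda>n. eps n < 1) sequentially"
    using eps_lim by (rule order_tendstoD) simp
  ultimately have "eventually (\<lambda>n. large_order (real n) \<and> eps n < 1) sequentially"
    by (rule eventually_conj)
  then obtain N0 where N0: "\<And>n. n \<ge> N0 \<Longrightarrow> large_order (real n) \<and> eps n < 1"
    by (auto simp: eventually_sequentially)
  have "real (cop_number G) \<le> (24 / c + 2) * sqrt (real n)" if n: "n \<ge> N0" and G: "G \<in> Gs n" for n G
  proof -
    have card: "card (verts G) = n" and simple: "simple_graph G" using graphs[OF G] by auto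
    interpret expander_graph G "d n" c "real (card (verts G))" "ln (real (card (verts G)))"
    proof unfold_locales
      show "real (card (\<Union>v\<in>S. ball_nbhd G v r)) \<le> 2 * (real (card S) * d n ^ r)"
        if S: "S \<subseteq> verts G"
          "real (card S) * d n ^ r < real (card (verts G)) / ln (real (card (verts G)))" for S r
      proof -
        \<comment> \<open>The cube of a nonnegative logarithm bounds \<open>d n\<close> from below,
          which gives the sign needed to multiply the bound on \<open>eps n\<close>.\<close>
        have "0 \<le> ln (real n)" using N0[OF n] by (simp add: large_order_def)
        then have "0 \<le> d n" using d_ge[of n] by (meson order_trans zero_le_power)
        then have "eps n * (real (card S) * d n ^ r) \<le> 1 * (real (card S) * d n ^ r)"
          using N0[OF n] by (intro mult_right_mono) auto
        then show ?thesis using prop_i_sharp[OF G S(1), of r] S(2) card by simp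
      qed
    qed (use simple card N0[OF n] c_pos d_ge prop_i[OF G] in auto)
    show ?thesis using cop_number_le_sqrt card by simp
  qed
  then show ?thesis by blast
qed

end
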